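(* Let $\Gamma$ be a groupoid and let $R$ be a $\Gamma$-graded ring. The following statements hold: (1) Suppose that $R$ is right $\Gamma_0$-artinian and that there exists a positive integer $k$ such that $\mathrm{rad}^{\mathrm{gr}}(R)^k=\mathrm{rad}^{\mathrm{gr}}(R)^{k+1}$. Then $\mathrm{rad}^{\mathrm{gr}}(R)$ is the largest nilpotent graded left ideal and the largest nilpotent graded right ideal of $R$. (2) If $R$ is right strongly $\Gamma_0$-artinian, then $\mathrm{rad}^{\mathrm{gr}}(R)$ is the largest nilpotent graded left ideal and the largest nilpotent graded right ideal of $R$. (3) If $R$ is right gr-artinian, then $\mathrm{rad}^{\mathrm{gr}}(R)$ is the largest nilpotent graded left ideal and the largest nilpotent graded right ideal of $R$.
   Context: A groupoid $\Gamma$ is the set of morphisms of a small category in which all morphisms are invertible; $\Gamma_0\subseteq\Gamma$ is the set of identity morphisms; $d(\gamma)=\gamma^{-1}\gamma$, $r(\gamma)=\gamma\gamma^{-1}$; the product $\gamma\delta$ is defined iff $d(\gamma)=r(\delta)$. Rings are associative, not necessarily unital. A $\Gamma$-graded ring is a ring $R=\bigoplus_{\gamma\in\Gamma}R_\gamma$ (additive subgroups) with $R_\gamma R_\delta\subseteq R_{\gamma\delta}$ if $d(\gamma)=r(\delta)$ and $R_\gamma R_\delta=0$ otherwise; it is always assumed object unital: for each $e\in\Gamma_0$ the ring $R_e$ has an identity $1_e$ (possibly $0$) with $1_{r(\gamma)}a=a=a1_{d(\gamma)}$ for all $a\in R_\gamma$, $\gamma\in\Gamma$. One- or two-sided ideals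 $U$ are graded if $U=\bigoplus_\gamma (U\cap R_\gamma)$. For a graded right ideal $U$ and $e\in\Gamma_0$, $U(e):=1_eU$. $R$ is right gr-artinian if it has no infinite strictly decreasing chain of graded right ideals; right $\Gamma_0$-artinian if for every $e\in\Gamma_0$ there is no infinite strictly decreasing chain of graded right ideals contained in $1_eR$; right strongly $\Gamma_0$-artinian if there is no infinite strictly decreasing chain $\{U_i\}_{i\ge1}$ of graded right ideals of $R$ such that for all $e\in\Gamma_0$ and $i\ge 1$: $U_i(e)=U_{i+1}(e)$ implies $U_i(e)=U_{i+l}(e)$ for all $l\ge1$. $\mathrm{rad}^{\mathrm{gr}}(R)$ is the intersection of all gr-maximal graded right ideals (those maximal among proper graded right ideals); it is a graded two-sided ideal. A one- or two-sided ideal $U$ is nilpotent if $U^n=0$ for some positive integer $n$. *)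

theory Defs
  imports Complex_Main
begin

section \<open>Groupoids\<close>

text \<open>
  A small category is given by its set of morphisms: objects are identified with identity
  morphisms, so that domain \<open>d\<close> and range \<open>r\<close> are again morphisms. The product \<open>\<gamma> \<cdot> \<delta>\<close> is
  meaningful only if \<open>d \<gamma> = r \<delta>\<close>; its value is unconstrained otherwise.
\<close>

locale small_category =
  fixes \<Gamma> :: "'g set"
    and comp :: "'g \<Rightarrow> 'g \<Rightarrow> 'g" (infixl "\<cdot>" 70)
    and d :: "'g \<Rightarrow> 'g"
    and r :: "'g \<Rightarrow> 'g"
  assumes d_closed: "\<gamma> \<in> \<Gamma> \<Longrightarrow> d \<gamma> \<in> \<Gamma>"
    and r_closed: "\<gamma> \<in> \<Gamma> \<Longrightarrow> r \<gamma> \<in> \<Gamma>"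
    and d_d: "\<gamma> \<in> \<Gamma> \<Longrightarrow> d (d \<gamma>) = d \<gamma>"
    and r_d: "\<gamma> \<in> \<Gamma> \<Longrightarrow> r (d \<gamma>) = d \<gamma>"
    and d_r: "\<gamma> \<in> \<Gamma> \<Longrightarrow> d (r \<gamma>) = r \<gamma>"
    and r_r: "\<gamma> \<in> \<Gamma> \<Longrightarrow> r (r \<gamma>) = r \<gamma>"
    and comp_closed: "\<gamma> \<in> \<Gamma> \<Longrightarrow> \<delta> \<in> \<Gamma> \<Longrightarrow> d \<gamma> = r \<delta> \<Longrightarrow> \<gamma> \<cdot> \<delta> \<in> \<Gamma>"
    and d_comp: "\<gamma> \<in> \<Gamma> \<Longrightarrow> \<delta> \<in> \<Gamma> \<Longrightarrow> d \<gamma> = r \<delta> \<Longrightarrow> d (\<gamma> \<cdot> \<delta>) = d \<delta>"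
    and r_comp: "\<gamma> \<in> \<Gamma> \<Longrightarrow> \<delta> \<in> \<Gamma> \<Longrightarrow> d \<gamma> = r \<delta> \<Longrightarrow> r (\<gamma> \<cdot> \<delta>) = r \<gamma>"
    and comp_assoc: "\<gamma> \<in> \<Gamma> \<Longrightarrow> \<delta> \<in> \<Gamma> \<Longrightarrow> \<epsilon> \<in> \<Gamma> \<Longrightarrow> d \<gamma> = r \<delta> \<Longrightarrow> d \<delta> = r \<epsilon> \<Longrightarrow>
      (\<gamma> \<cdot> \<delta>) \<cdot> \<epsilon> = \<gamma> \<cdot> (\<delta> \<cdot> \<epsilon>)"
    and comp_d: "\<gamma> \<in> \<Gamma> \<Longrightarrow> \<gamma> \<cdot> d \<gamma> = \<gamma>"
    and r_comp_left: "\<gamma> \<in> \<Gamma> \<Longrightarrow> r \<gamma> \<cdot> \<gamma> = \<gamma>"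

locale groupoid = small_category +
  assumes invertible: "\<gamma> \<in> \<Gamma> \<Longrightarrow>
    \<exists>\<delta>\<in>\<Gamma>. d \<delta> = r \<gamma> \<and> r \<delta> = d \<gamma> \<and> \<delta> \<cdot> \<gamma> = d \<gamma> \<and> \<gamma> \<cdot> \<delta> = r \<gamma>"

definition identities :: "'g set \<Rightarrow> ('g \<Rightarrow> 'g) \<Rightarrow> 'g set" where
  "identities \<Gamma> d = d ` \<Gamma>"

section \<open>Direct sums of additive subgroups\<close>

definition add_subgroup :: "'r::ab_group_add set \<Rightarrow> bool" where
  "add_subgroup A \<longleftrightarrow> 0 \<in> A \<and> (\<forall>a\<in>A. \<forall>b\<in>A. a + b \<in> A) \<and> (\<forall>a\<in>A. - a \<in> A)"

definition finsupp_families :: "'i set \<Rightarrow> ('i \<Rightarrow> 'r::ab_group_add set) \<Rightarrow> ('i \<Rightarrow> 'r) set" where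
  "finsupp_families I M =
    {f. (\<forall>i\<in>I. f i \<in> M i) \<and> (\<forall>i. i \<notin> I \<longrightarrow> f i = 0) \<and> finite {i. f i \<noteq> 0}}"

definition is_direct_sum :: "'i set \<Rightarrow> ('i \<Rightarrow> 'r::ab_group_add set) \<Rightarrow> 'r set \<Rightarrow> bool" where
  "is_direct_sum I M A \<longleftrightarrow>
    (\<forall>i\<in>I. add_subgroup (M i)) \<and>
    bij_betw (\<lambda>f. \<Sum>i | f i \<noteq> 0. f i) (finsupp_families I M) A"

section \<open>Object unital groupoid graded rings\<close>

text \<open>
  The ring is the whole type \<open>'r\<close>; class \<open>ring\<close> does not provide a multiplicative unit.
  The element \<open>u e\<close> is the identity of the ring \<open>R e\<close>, hence it is determined by the grading.
\<close>

locale graded_ring = groupoid \<Gamma> comp d r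
  for \<Gamma> :: "'g set"
    and comp :: "'g \<Rightarrow> 'g \<Rightarrow> 'g" (infixl "\<cdot>" 70)
    and d :: "'g \<Rightarrow> 'g"
    and r :: "'g \<Rightarrow> 'g" +
  fixes R :: "'g \<Rightarrow> 'r::ring set"
    and u :: "'g \<Rightarrow> 'r"
  assumes direct_sum: "is_direct_sum \<Gamma> R UNIV"
    and mult_comp: "\<gamma> \<in> \<Gamma> \<Longrightarrow> \<delta> \<in> \<Gamma> \<Longrightarrow> d \<gamma> = r \<delta> \<Longrightarrow> a \<in> R \<gamma> \<Longrightarrow> b \<in> R \<delta> \<Longrightarrow> a * b \<in> R (\<gamma> \<cdot> \<delta>)"
    and mult_zero: "\<gamma> \<in> \<Gamma> \<Longrightarrow> \<delta> \<in> \<Gamma> \<Longrightarrow> d \<gamma> \<noteq> r \<delta> \<Longrightarrow> a \<in> R \<gamma> \<Longrightarrow> b \<in> R \<delta> \<Longrightarrow> a * b = 0"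
    and unit_mem: "e \<in> identities \<Gamma> d \<Longrightarrow> u e \<in> R e"
    and unit_left: "\<gamma> \<in> \<Gamma> \<Longrightarrow> a \<in> R \<gamma> \<Longrightarrow> u (r \<gamma>) * a = a"
    and unit_right: "\<gamma> \<in> \<Gamma> \<Longrightarrow> a \<in> R \<gamma> \<Longrightarrow> a * u (d \<gamma>) = a"

section \<open>Graded one-sided ideals\<close>

definition right_ideal :: "'r::ring set \<Rightarrow> bool" where
  "right_ideal U \<longleftrightarrow> add_subgroup U \<and> (\<forall>a\<in>U. \<forall>x. a * x \<in> U)"

definition left_ideal :: "'r::ring set \<Rightarrow> bool" where
  "left_ideal U \<longleftrightarrow> add_subgroup U \<and> (\<forall>a\<in>U. \<forall>x. x * a \<in> U)"

definition graded_right_ideal :: "'g set \<Rightarrow> ('g \<Rightarrow> 'r::ring set) \<Rightarrow> 'r set \<Rightarrow> bool" where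
  "graded_right_ideal \<Gamma> R U \<longleftrightarrow> right_ideal U \<and> is_direct_sum \<Gamma> (\<lambda>\<gamma>. U \<inter> R \<gamma>) U"

definition graded_left_ideal :: "'g set \<Rightarrow> ('g \<Rightarrow> 'r::ring set) \<Rightarrow> 'r set \<Rightarrow> bool" where
  "graded_left_ideal \<Gamma> R U \<longleftrightarrow> left_ideal U \<and> is_direct_sum \<Gamma> (\<lambda>\<gamma>. U \<inter> R \<gamma>) U"

definition gr_maximal_right_ideal :: "'g set \<Rightarrow> ('g \<Rightarrow> 'r::ring set) \<Rightarrow> 'r set \<Rightarrow> bool" where
  "gr_maximal_right_ideal \<Gamma> R U \<longleftrightarrow> graded_right_ideal \<Gamma> R U \<and> U \<noteq> UNIV \<and>
    (\<forall>V. graded_right_ideal \<Gamma> R V \<and> V \<noteq> UNIV \<and> U \<subseteq> V \<longrightarrow> V = U)"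

text \<open>The intersection of the empty family is the whole ring; this matters only if the ring is \<open>0\<close>.\<close>

definition gr_rad :: "'g set \<Rightarrow> ('g \<Rightarrow> 'r::ring set) \<Rightarrow> 'r set" where
  "gr_rad \<Gamma> R = \<Inter>{U. gr_maximal_right_ideal \<Gamma> R U}"

section \<open>Powers and nilpotency\<close>

definition ideal_prod :: "'r::ring set \<Rightarrow> 'r set \<Rightarrow> 'r set" where
  "ideal_prod U V = add_subgroup hull {a * b | a b. a \<in> U \<and> b \<in> V}"

text \<open>Only positive exponents are used; the value at exponent \<open>0\<close> is a mere convention.\<close>

fun ideal_power :: "'r::ring set \<Rightarrow> nat \<Rightarrow> 'r set" where
  "ideal_power U 0 = UNIV"
| "ideal_power U (Suc 0) = U"
| "ideal_power U (Suc (Suc n)) = ideal_prod (ideal_power U (Suc n)) U"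

definition nilpotent_ideal :: "'r::ring set \<Rightarrow> bool" where
  "nilpotent_ideal U \<longleftrightarrow> (\<exists>n\<ge>1. ideal_power U n = {0})"

definition is_largest :: "('r set \<Rightarrow> bool) \<Rightarrow> 'r set \<Rightarrow> bool" where
  "is_largest P U \<longleftrightarrow> P U \<and> (\<forall>V. P V \<longrightarrow> V \<subseteq> U)"

section \<open>Chain conditions\<close>

definition right_gr_artinian :: "'g set \<Rightarrow> ('g \<Rightarrow> 'r::ring set) \<Rightarrow> bool" where
  "right_gr_artinian \<Gamma> R \<longleftrightarrow>
    \<not> (\<exists>U :: nat \<Rightarrow> 'r set. (\<forall>i. graded_right_ideal \<Gamma> R (U i)) \<and> (\<forall>i. U (Suc i) \<subset> U i))"

definition unit_part :: "('g \<Rightarrow> 'r::ring) \<Rightarrow> 'g \<Rightarrow> 'r set \<Rightarrow> 'r set" where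
  "unit_part u e U = (\<lambda>a. u e * a) ` U"

definition right_\<Gamma>0_artinian ::
    "'g set \<Rightarrow> ('g \<Rightarrow> 'g) \<Rightarrow> ('g \<Rightarrow> 'r::ring set) \<Rightarrow> ('g \<Rightarrow> 'r) \<Rightarrow> bool" where
  "right_\<Gamma>0_artinian \<Gamma> d R u \<longleftrightarrow>
    (\<forall>e\<in>identities \<Gamma> d.
      \<not> (\<exists>U :: nat \<Rightarrow> 'r set.
          (\<forall>i. graded_right_ideal \<Gamma> R (U i) \<and> U i \<subseteq> unit_part u e UNIV) \<and>
          (\<forall>i. U (Suc i) \<subset> U i)))"

definition right_strongly_\<Gamma>0_artinian ::
    "'g set \<Rightarrow> ('g \<Rightarrow> 'g) \<Rightarrow> ('g \<Rightarrow> 'r::ring set) \<Rightarrow> ('g \<Rightarrow> 'r) \<Rightarrow> bool" where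
  "right_strongly_\<Gamma>0_artinian \<Gamma> d R u \<longleftrightarrow>
    \<not> (\<exists>U :: nat \<Rightarrow> 'r set.
        (\<forall>i. graded_right_ideal \<Gamma> R (U i)) \<and>
        (\<forall>i. U (Suc i) \<subset> U i) \<and>
        (\<forall>e\<in>identities \<Gamma> d. \<forall>i. unit_part u e (U i) = unit_part u e (U (Suc i)) \<longrightarrow>
          (\<forall>l\<ge>1. unit_part u e (U i) = unit_part u e (U (i + l)))))"

end

theory Submission
  imports Defs
begin

text \<open>
  Nilpotent graded one-sided ideals lie in every gr-maximal right ideal \<open>M\<close>: for a homogeneous
  element \<open>a\<close> of range \<open>f\<close> in such an ideal with \<open>a \<notin> M\<close> one has \<open>1\<^sub>f = m + a x\<close> with \<open>m \<in> M\<close>, and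
  multiplying repeatedly by \<open>a x\<close> pushes \<open>1\<^sub>f\<close> into \<open>M\<close>. Left multiplication by a homogeneous \<open>c\<close>
  pulls \<open>M\<close> back to a gr-maximal right ideal or to the whole ring, so \<open>J = rad\<^sup>g\<^sup>r(R)\<close> is
  two-sided.

  If \<open>J\<^sup>k = J\<^sup>k\<^sup>+\<^sup>1 = I \<noteq> 0\<close> and \<open>R\<close> is right \<open>\<Gamma>\<^sub>0\<close>-artinian, choose a graded right ideal \<open>U\<close> in some
  \<open>1\<^sub>e R\<close> minimal subject to \<open>U I \<noteq> 0\<close>. Then \<open>U = a I\<close> for a homogeneous \<open>a \<in> U\<close>, hence \<open>a \<in> a J\<close>, which
  forces \<open>a = 0\<close> as the right annihilator of \<open>a\<close> would otherwise lie in a gr-maximal right ideal.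
  The other two chain conditions both imply right \<open>\<Gamma>\<^sub>0\<close>-artinian and the stabilization of the
  powers of \<open>J\<close>.
\<close>

section \<open>Additive subgroups and products of ideals\<close>

lemma add_subgroupD:
  assumes "add_subgroup A"
  shows "0 \<in> A" "a \<in> A \<Longrightarrow> b \<in> A \<Longrightarrow> a + b \<in> A" "a \<in> A \<Longrightarrow> - a \<in> A"
    "a \<in> A \<Longrightarrow> b \<in> A \<Longrightarrow> a - b \<in> A"
  using assms unfolding add_subgroup_def by (auto, metis diff_conv_add_uminus)

lemma add_subgroup_sum:
  "add_subgroup A \<Longrightarrow> (\<And>i. i \<in> F \<Longrightarrow> f i \<in> A) \<Longrightarrow> sum f F \<in> A"
  by (induction F rule: infinite_finite_induct) (auto simp: add_subgroupD)

lemma add_subgroup_hull: "add_subgroup (add_subgroup hull S)"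
  unfolding hull_def add_subgroup_def by auto

text \<open>Minimality of the hull replaces induction on finite sums of products: a property of all
  elements of a product of ideals is proved by showing that it defines an additive subgroup and
  holds for each \<open>a * b\<close>.\<close>

lemma ideal_prod_subset_iff:
  "add_subgroup T \<Longrightarrow> ideal_prod A B \<subseteq> T \<longleftrightarrow> (\<forall>a\<in>A. \<forall>b\<in>B. a * b \<in> T)"
proof
  assume T: "add_subgroup T" and "\<forall>a\<in>A. \<forall>b\<in>B. a * b \<in> T"
  then show "ideal_prod A B \<subseteq> T"
    unfolding ideal_prod_def by (intro hull_minimal) auto
next
  assume "ideal_prod A B \<subseteq> T"
  then show "\<forall>a\<in>A. \<forall>b\<in>B. a * b \<in> T"
    unfolding ideal_prod_def using hull_subset[of "{a * b |a b. a \<in> A \<and> b \<in> B}" add_subgroup]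
    by blast
qed

lemma add_subgroup_ideal_prod: "add_subgroup (ideal_prod A B)"
  unfolding ideal_prod_def by (rule add_subgroup_hull)

lemma ideal_prodI: "a \<in> A \<Longrightarrow> b \<in> B \<Longrightarrow> a * b \<in> ideal_prod A B"
  using ideal_prod_subset_iff[OF add_subgroup_ideal_prod, of A B A B] by blast

text \<open>The elements that every \<open>c \<in> C\<close> multiplies from the right into the
  target form an additive subgroup, so only \<open>x = a * b\<close> has to be tested, where
  associativity moves the bracket.\<close>

lemma ideal_prod_assoc_subset:
  "ideal_prod (ideal_prod A B) C \<subseteq> ideal_prod A (ideal_prod B C)"
proof -
  let ?T = "ideal_prod A (ideal_prod B C)"
  have "ideal_prod A B \<subseteq> {x. \<forall>c\<in>C. x * c \<in> ?T}"
  proof (subst ideal_prod_subset_iff)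
    show "add_subgroup {x. \<forall>c\<in>C. x * c \<in> ?T}"
      using add_subgroup_ideal_prod[of A "ideal_prod B C"]
      unfolding add_subgroup_def by (auto simp: distrib_right)
    show "\<forall>a\<in>A. \<forall>b\<in>B. a * b \<in> {x. \<forall>c\<in>C. x * c \<in> ?T}"
      by (auto simp: mult.assoc intro!: ideal_prodI)
  qed
  then show ?thesis
    by (subst ideal_prod_subset_iff[OF add_subgroup_ideal_prod]) blast
qed

lemma ideal_prod_mono: "A \<subseteq> A' \<Longrightarrow> B \<subseteq> B' \<Longrightarrow> ideal_prod A B \<subseteq> ideal_prod A' B'"
  by (subst ideal_prod_subset_iff[OF add_subgroup_ideal_prod]) (blast intro: ideal_prodI)

section \<open>Powers of one-sided ideals\<close>

lemma ideal_power_Suc: "n \<ge> 1 \<Longrightarrow> ideal_power U (Suc n) = ideal_prod (ideal_power U n) U"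
  by (cases n) auto

text \<open>Powers are bracketed to the left, so the induction splits off the last factor and
  reassociates. With \<open>m = n = k\<close> a stable power \<open>I\<close> satisfies
  \<open>I \<subseteq> ideal_prod I I\<close>.\<close>

lemma ideal_power_add_subset:
  assumes "m \<ge> 1" "n \<ge> 1"
  shows "ideal_power U (m + n) \<subseteq> ideal_prod (ideal_power U m) (ideal_power U n)"
  using assms(2)
proof (induction n rule: dec_induct)
  case base
  then show ?case using ideal_power_Suc[OF assms(1), of U] by simp
next
  case (step n)
  have "ideal_power U (m + Suc n) = ideal_prod (ideal_power U (m + n)) U"
    using ideal_power_Suc[of "m + n" U] assms(1) by simp
  also have "\<dots> \<subseteq> ideal_prod (ideal_prod (ideal_power U m) (ideal_power U n)) U"
    by (rule ideal_prod_mono[OF step.IH]) simp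
  also have "\<dots> \<subseteq> ideal_prod (ideal_power U m) (ideal_prod (ideal_power U n) U)"
    by (rule ideal_prod_assoc_subset)
  finally show ?case using ideal_power_Suc[OF step.hyps(1), of U] by simp
qed

lemma ideal_power_stable:
  assumes "k \<ge> 1" "ideal_power U k = ideal_power U (k + 1)"
  shows "ideal_power U (k + l) = ideal_power U k"
proof (induction l)
  case (Suc l)
  then show ?case
    using ideal_power_Suc[of "k + l" U] ideal_power_Suc[of k U] assms(1) assms(2)[symmetric] by simp
qed simp

lemma right_ideal_ideal_prod:
  assumes "right_ideal B"
  shows "right_ideal (ideal_prod A B)"
proof -
  have "ideal_prod A B \<subseteq> {y. \<forall>x. y * x \<in> ideal_prod A B}"
  proof (subst ideal_prod_subset_iff)
    show "add_subgroup {y. \<forall>x. y * x \<in> ideal_prod A B}"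
      using add_subgroup_ideal_prod[of A B] unfolding add_subgroup_def
      by (auto simp: distrib_right)
    show "\<forall>a\<in>A. \<forall>b\<in>B. a * b \<in> {y. \<forall>x. y * x \<in> ideal_prod A B}"
      using assms unfolding right_ideal_def by (auto simp: mult.assoc intro!: ideal_prodI)
  qed
  then show ?thesis using add_subgroup_ideal_prod unfolding right_ideal_def by blast
qed

lemma ideal_power_Suc_subset:
  assumes "right_ideal U" "n \<ge> 1"
  shows "right_ideal (ideal_power U n)" "ideal_power U (Suc n) \<subseteq> ideal_power U n"
proof -
  show *: "right_ideal (ideal_power U n)"
    using assms(2)
  proof (induction n rule: dec_induct)
    case (step n)
    then show ?case using right_ideal_ideal_prod[OF assms(1)] by (simp add: ideal_power_Suc)
  qed (use assms in simp)
  show "ideal_power U (Suc n) \<subseteq> ideal_power U n"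
    using * unfolding ideal_power_Suc[OF assms(2)] right_ideal_def
    by (subst ideal_prod_subset_iff) auto
qed

lemma ideal_power_subset:
  assumes "right_ideal U" "n \<ge> 1"
  shows "ideal_power U n \<subseteq> U"
  using assms(2)
proof (induction n rule: dec_induct)
  case (step n)
  then show ?case using ideal_power_Suc_subset(2)[OF assms(1)] by blast
qed simp

section \<open>Homogeneous components\<close>

context graded_ring
begin

text \<open>The homogeneous decomposition of an element: summation is a bijection from the finitely
  supported families onto the ring, so \<open>inv_into\<close> picks the only preimage.\<close>

definition component :: "'r \<Rightarrow> 'g \<Rightarrow> 'r" where
  "component = inv_into (finsupp_families \<Gamma> R) (\<lambda>f. \<Sum>i | f i \<noteq> 0. f i)"

lemma add_subgroup_R: "\<gamma> \<in> \<Gamma> \<Longrightarrow> add_subgroup (R \<gamma>)"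
  using direct_sum unfolding is_direct_sum_def by blast

lemma bij_sum: "bij_betw (\<lambda>f. \<Sum>i | f i \<noteq> 0. f i) (finsupp_families \<Gamma> R) UNIV"
  using direct_sum unfolding is_direct_sum_def by blast

lemma component_family: "component x \<in> finsupp_families \<Gamma> R"
  unfolding component_def using bij_sum by (intro inv_into_into) (simp add: bij_betw_def)

lemma component_mem: "\<gamma> \<in> \<Gamma> \<Longrightarrow> component x \<gamma> \<in> R \<gamma>"
  and finite_component: "finite {\<gamma>. component x \<gamma> \<noteq> 0}"
  and component_outside: "component x \<gamma> \<noteq> 0 \<Longrightarrow> \<gamma> \<in> \<Gamma>"
  using component_family[of x] unfolding finsupp_families_def by auto

lemma sum_component: "(\<Sum>\<gamma> | component x \<gamma> \<noteq> 0. component x \<gamma>) = x"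
  unfolding component_def
  by (rule f_inv_into_f[where f = "\<lambda>f. \<Sum>i | f i \<noteq> 0. f i"])
    (use bij_sum in \<open>simp add: bij_betw_def\<close>)

lemma component_unique:
  assumes "f \<in> finsupp_families \<Gamma> R" "(\<Sum>i | f i \<noteq> 0. f i) = x"
  shows "component x = f"
  unfolding component_def assms(2)[symmetric]
  using bij_sum assms(1) by (intro inv_into_f_eq) (auto simp: bij_betw_def)

text \<open>\<open>F\<close> may exceed the support of \<open>f\<close>, so that two decompositions
  can be added over the union of their supports.\<close>

lemma component_eqI:
  assumes "finite F" "F \<subseteq> \<Gamma>" "\<And>\<gamma>. \<gamma> \<in> F \<Longrightarrow> f \<gamma> \<in> R \<gamma>" "\<And>\<gamma>. \<gamma> \<notin> F \<Longrightarrow> f \<gamma> = 0"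
    and "sum f F = x"
  shows "component x = f"
proof (rule component_unique)
  have "{i. f i \<noteq> 0} \<subseteq> F" using assms(4) by auto
  moreover have "f \<gamma> \<in> R \<gamma>" if "\<gamma> \<in> \<Gamma>" for \<gamma>
    using assms(3,4) add_subgroupD(1)[OF add_subgroup_R[OF that]] by (cases "\<gamma> \<in> F") auto
  ultimately show "f \<in> finsupp_families \<Gamma> R"
    using assms(1,2,4) unfolding finsupp_families_def by (blast intro: finite_subset)
  have "(\<Sum>i | f i \<noteq> 0. f i) = sum f F"
    using assms(1) \<open>{i. f i \<noteq> 0} \<subseteq> F\<close> by (intro sum.mono_neutral_left) auto
  then show "(\<Sum>i | f i \<noteq> 0. f i) = x" using assms(5) by simp
qed

lemma component_add: "component (x + y) = (\<lambda>\<gamma>. component x \<gamma> + component y \<gamma>)"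
proof (rule component_eqI)
  let ?X = "{\<gamma>. component x \<gamma> \<noteq> 0}" and ?Y = "{\<gamma>. component y \<gamma> \<noteq> 0}"
  show "finite (?X \<union> ?Y)" using finite_component by blast
  show "?X \<union> ?Y \<subseteq> \<Gamma>" using component_outside by blast
  then show "component x \<gamma> + component y \<gamma> \<in> R \<gamma>" if "\<gamma> \<in> ?X \<union> ?Y" for \<gamma>
    using that by (intro add_subgroupD(2) add_subgroup_R component_mem) auto
  have "sum (component x) (?X \<union> ?Y) = sum (component x) ?X"
    "sum (component y) (?X \<union> ?Y) = sum (component y) ?Y"
    using finite_component by (intro sum.mono_neutral_right; auto)+
  then show "(\<Sum>\<gamma>\<in>?X \<union> ?Y. component x \<gamma> + component y \<gamma>) = x + y"
    by (simp add: sum.distrib sum_component)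
qed auto

lemma component_zero: "component 0 \<gamma> = 0"
  using fun_cong[OF component_add[of 0 0], of \<gamma>] by simp

lemma component_uminus: "component (- x) \<gamma> = - component x \<gamma>"
  using fun_cong[OF component_add[of x "- x"], of \<gamma>] component_zero[of \<gamma>]
  by (simp add: eq_neg_iff_add_eq_0 add.commute)

lemma component_sum: "component (sum f F) \<gamma> = (\<Sum>i\<in>F. component (f i) \<gamma>)"
  by (induction F rule: infinite_finite_induct) (auto simp: component_add component_zero)

lemma component_hom:
  assumes "\<gamma> \<in> \<Gamma>" "a \<in> R \<gamma>"
  shows "component a = (\<lambda>\<delta>. if \<delta> = \<gamma> then a else 0)"
  by (rule component_eqI[where F = "{\<gamma>}"]) (use assms in auto)

section \<open>Left multiplication by a homogeneous element\<close>

lemma comp_left_cancel: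
  assumes "\<gamma> \<in> \<Gamma>" "\<beta> \<in> \<Gamma>" "\<beta>' \<in> \<Gamma>" "d \<gamma> = r \<beta>" "d \<gamma> = r \<beta>'" "\<gamma> \<cdot> \<beta> = \<gamma> \<cdot> \<beta>'"
  shows "\<beta> = \<beta>'"
proof -
  obtain \<delta> where \<delta>: "\<delta> \<in> \<Gamma>" "d \<delta> = r \<gamma>" "\<delta> \<cdot> \<gamma> = d \<gamma>"
    using invertible[OF assms(1)] by blast
  have "\<delta> \<cdot> (\<gamma> \<cdot> \<alpha>) = \<alpha>" if "\<alpha> \<in> \<Gamma>" "d \<gamma> = r \<alpha>" for \<alpha>
    using comp_assoc[of \<delta> \<gamma> \<alpha>] r_comp_left[OF that(1)] \<delta> that assms(1) by simp
  then show ?thesis using assms by metis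
qed

lemma eq_sum_mult_component: "y * x = (\<Sum>\<beta> | component x \<beta> \<noteq> 0. y * component x \<beta>)"
  by (simp add: sum_component flip: sum_distrib_left)

lemma eq_sum_component_mult: "x * y = (\<Sum>\<beta> | component x \<beta> \<noteq> 0. component x \<beta> * y)"
  by (simp add: sum_component flip: sum_distrib_right)

lemma component_mult:
  assumes "\<gamma> \<in> \<Gamma>" "a \<in> R \<gamma>"
  shows "component (a * x) \<delta> =
    (\<Sum>\<beta> | component x \<beta> \<noteq> 0. if d \<gamma> = r \<beta> \<and> \<gamma> \<cdot> \<beta> = \<delta> then a * component x \<beta> else 0)"
proof -
  have "component (a * x) \<delta> = component (\<Sum>\<beta> | component x \<beta> \<noteq> 0. a * component x \<beta>) \<delta>"
    by (simp add: eq_sum_mult_component[of a x])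
  also have "\<dots> = (\<Sum>\<beta> | component x \<beta> \<noteq> 0. component (a * component x \<beta>) \<delta>)"
    by (rule component_sum)
  also have "\<dots> = (\<Sum>\<beta> | component x \<beta> \<noteq> 0.
      if d \<gamma> = r \<beta> \<and> \<gamma> \<cdot> \<beta> = \<delta> then a * component x \<beta> else 0)"
  proof (rule sum.cong[OF refl])
    fix \<beta> assume "\<beta> \<in> {\<beta>. component x \<beta> \<noteq> 0}"
    then have \<beta>: "\<beta> \<in> \<Gamma>" using component_outside by auto
    show "component (a * component x \<beta>) \<delta> =
        (if d \<gamma> = r \<beta> \<and> \<gamma> \<cdot> \<beta> = \<delta> then a * component x \<beta> else 0)"
    proof (cases "d \<gamma> = r \<beta>")
      case True
      then have "a * component x \<beta> \<in> R (\<gamma> \<cdot> \<beta>)" "\<gamma> \<cdot> \<beta> \<in> \<Gamma>"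
        using mult_comp comp_closed component_mem assms \<beta> by auto
      then show ?thesis using component_hom True by auto
    next
      case False
      then have "a * component x \<beta> = 0" using mult_zero component_mem assms \<beta> by auto
      then show ?thesis using component_zero False by auto
    qed
  qed
  finally show ?thesis .
qed

text \<open>By \<open>comp_left_cancel\<close>, which rests on invertibility, no degree other than
  \<open>\<beta>\<close> is moved to \<open>\<gamma> \<cdot> \<beta>\<close>, so the sum in
  \<open>component_mult\<close> collapses to one term.\<close>

lemma component_mult_comp:
  assumes "\<gamma> \<in> \<Gamma>" "a \<in> R \<gamma>" "\<beta> \<in> \<Gamma>" "d \<gamma> = r \<beta>"
  shows "component (a * x) (\<gamma> \<cdot> \<beta>) = a * component x \<beta>"
proof -
  have "component (a * x) (\<gamma> \<cdot> \<beta>) =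
      (\<Sum>\<beta>' | component x \<beta>' \<noteq> 0. if \<beta>' = \<beta> then a * component x \<beta>' else 0)"
    unfolding component_mult[OF assms(1,2)]
    using comp_left_cancel assms component_outside by (intro sum.cong[OF refl] if_cong) auto
  also have "\<dots> = a * component x \<beta>"
    using finite_component by (simp add: sum.delta)
  finally show ?thesis .
qed

text \<open>If \<open>\<delta>\<close> is not a product of \<open>\<gamma>\<close> with a composable
  morphism, every term of the sum vanishes. Closure arguments for \<open>a V\<close> and for
  products of ideals need only this form, without degrees.\<close>

lemma component_mult_cases:
  assumes "\<gamma> \<in> \<Gamma>" "a \<in> R \<gamma>"
  shows "component (a * x) \<delta> = 0 \<or> (\<exists>\<beta>\<in>\<Gamma>. component (a * x) \<delta> = a * component x \<beta>)"
proof (cases "\<exists>\<beta>\<in>\<Gamma>. d \<gamma> = r \<beta> \<and> \<gamma> \<cdot> \<beta> = \<delta>")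
  case True
  then show ?thesis using component_mult_comp[OF assms] by blast
next
  case False
  then show ?thesis unfolding component_mult[OF assms]
    using component_outside by (auto intro!: sum.neutral)
qed

section \<open>Graded right ideals\<close>

text \<open>The working form of gradedness; for additive subgroups \<open>direct_sum_iff\<close>
  identifies it with the direct sum condition.\<close>

definition homogeneous_closed :: "'r set \<Rightarrow> bool" where
  "homogeneous_closed U \<longleftrightarrow> (\<forall>x\<in>U. \<forall>\<gamma>\<in>\<Gamma>. component x \<gamma> \<in> U)"

lemma component_in: "homogeneous_closed U \<Longrightarrow> add_subgroup U \<Longrightarrow> x \<in> U \<Longrightarrow> component x \<gamma> \<in> U"
  unfolding homogeneous_closed_def using component_outside[of x \<gamma>] add_subgroupD(1)[of U]
  by (cases "component x \<gamma> = 0") auto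

lemma direct_sum_iff:
  assumes "add_subgroup U"
  shows "is_direct_sum \<Gamma> (\<lambda>\<gamma>. U \<inter> R \<gamma>) U \<longleftrightarrow> homogeneous_closed U"
proof
  let ?F = "finsupp_families \<Gamma> (\<lambda>\<gamma>. U \<inter> R \<gamma>)" and ?s = "\<lambda>f. \<Sum>i | f i \<noteq> 0. f i"
  have sub: "?F \<subseteq> finsupp_families \<Gamma> R" unfolding finsupp_families_def by auto
  show "homogeneous_closed U" if "is_direct_sum \<Gamma> (\<lambda>\<gamma>. U \<inter> R \<gamma>) U"
    unfolding homogeneous_closed_def
  proof (intro ballI)
    fix x \<gamma> assume "x \<in> U" "\<gamma> \<in> \<Gamma>"
    moreover have "?s ` ?F = U" using that unfolding is_direct_sum_def bij_betw_def by (elim conjE)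
    ultimately have "x \<in> ?s ` ?F" by simp
    then obtain f where f: "f \<in> ?F" "?s f = x" by (elim imageE) simp
    \<comment> \<open>A family with values in \<open>U \<inter> R \<gamma>\<close> is also a family
      for the whole ring, so uniqueness of the decomposition applies.\<close>
    then have "component x = f" using component_unique[OF subsetD[OF sub]] by simp
    then show "component x \<gamma> \<in> U" using f \<open>\<gamma> \<in> \<Gamma>\<close> unfolding finsupp_families_def by auto
  qed
  show "is_direct_sum \<Gamma> (\<lambda>\<gamma>. U \<inter> R \<gamma>) U" if U: "homogeneous_closed U"
  proof -
    have "inj_on ?s ?F"
      using bij_betw_imp_inj_on[OF bij_sum] sub by (rule inj_on_subset)
    moreover have "?s ` ?F = U"
    proof
      show "?s ` ?F \<subseteq> U"
      proof (rule image_subsetI)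
        fix f assume "f \<in> ?F"
        then show "?s f \<in> U"
          unfolding finsupp_families_def by (intro add_subgroup_sum[OF assms]) auto
      qed
      show "U \<subseteq> ?s ` ?F"
      proof
        fix x assume "x \<in> U"
        then have "component x \<in> ?F"
          using component_family[of x] component_in[OF U assms]
          unfolding finsupp_families_def by auto
        with sum_component[of x, symmetric] show "x \<in> ?s ` ?F" by (rule image_eqI)
      qed
    qed
    ultimately have "bij_betw ?s ?F U" unfolding bij_betw_def by (rule conjI)
    moreover have "add_subgroup (U \<inter> R \<gamma>)" if "\<gamma> \<in> \<Gamma>" for \<gamma>
      using assms add_subgroup_R[OF that] unfolding add_subgroup_def by auto
    ultimately show ?thesis unfolding is_direct_sum_def by blast
  qed
qed

lemma graded_right_ideal_iff:
  "graded_right_ideal \<Gamma> R U \<longleftrightarrow> right_ideal U \<and> homogeneous_closed U"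
  unfolding graded_right_ideal_def using direct_sum_iff right_ideal_def by blast

lemma graded_left_ideal_iff:
  "graded_left_ideal \<Gamma> R U \<longleftrightarrow> left_ideal U \<and> homogeneous_closed U"
  unfolding graded_left_ideal_def using direct_sum_iff left_ideal_def by blast

lemma subset_if_homogeneous:
  assumes "homogeneous_closed U" "add_subgroup V"
    and "\<And>a \<gamma>. \<gamma> \<in> \<Gamma> \<Longrightarrow> a \<in> R \<gamma> \<Longrightarrow> a \<in> U \<Longrightarrow> a \<in> V"
  shows "U \<subseteq> V"
proof
  fix x assume "x \<in> U"
  then have "component x \<gamma> \<in> V" if "\<gamma> \<in> \<Gamma>" for \<gamma>
    using assms(1,3) that component_mem[OF that] unfolding homogeneous_closed_def by blast
  then have "(\<Sum>\<gamma> | component x \<gamma> \<noteq> 0. component x \<gamma>) \<in> V"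
    using component_outside by (intro add_subgroup_sum[OF assms(2)]) blast
  then show "x \<in> V" by (simp add: sum_component)
qed

lemma graded_right_idealD:
  assumes "graded_right_ideal \<Gamma> R U"
  shows "add_subgroup U" "a \<in> U \<Longrightarrow> a * x \<in> U" "homogeneous_closed U"
  using assms unfolding graded_right_ideal_iff right_ideal_def by auto

lemma graded_right_idealI:
  assumes "add_subgroup U" "\<And>a x. a \<in> U \<Longrightarrow> a * x \<in> U"
    "\<And>x \<gamma>. x \<in> U \<Longrightarrow> \<gamma> \<in> \<Gamma> \<Longrightarrow> component x \<gamma> \<in> U"
  shows "graded_right_ideal \<Gamma> R U"
  using assms unfolding graded_right_ideal_iff right_ideal_def homogeneous_closed_def by auto

section \<open>Constructions of graded right ideals\<close>

lemma graded_right_ideal_UNIV: "graded_right_ideal \<Gamma> R UNIV"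
  by (rule graded_right_idealI) (auto simp: add_subgroup_def)

lemma graded_right_ideal_zero: "graded_right_ideal \<Gamma> R {0}"
  by (rule graded_right_idealI) (auto simp: add_subgroup_def component_zero)

lemma graded_right_ideal_Inter:
  "(\<And>U. U \<in> \<U> \<Longrightarrow> graded_right_ideal \<Gamma> R U) \<Longrightarrow> graded_right_ideal \<Gamma> R (\<Inter>\<U>)"
  unfolding graded_right_ideal_iff right_ideal_def homogeneous_closed_def add_subgroup_def
  by blast

lemma graded_right_ideal_plus:
  assumes "graded_right_ideal \<Gamma> R U" "graded_right_ideal \<Gamma> R V"
  shows "graded_right_ideal \<Gamma> R {x + y |x y. x \<in> U \<and> y \<in> V}"
proof (rule graded_right_idealI)
  note U = graded_right_idealD[OF assms(1)] and V = graded_right_idealD[OF assms(2)]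
  show "add_subgroup {x + y |x y. x \<in> U \<and> y \<in> V}"
    unfolding add_subgroup_def
  proof (intro conjI ballI)
    show "0 \<in> {x + y |x y. x \<in> U \<and> y \<in> V}"
      using add_subgroupD(1)[OF U(1)] add_subgroupD(1)[OF V(1)] by force
    fix a assume "a \<in> {x + y |x y. x \<in> U \<and> y \<in> V}"
    then obtain x y where a: "a = x + y" "x \<in> U" "y \<in> V" by blast
    have "- a = - x + - y" using a by simp
    then show "- a \<in> {x + y |x y. x \<in> U \<and> y \<in> V}"
      using a add_subgroupD(3) U(1) V(1) by blast
    fix b assume "b \<in> {x + y |x y. x \<in> U \<and> y \<in> V}"
    then obtain x' y' where b: "b = x' + y'" "x' \<in> U" "y' \<in> V" by blast
    have "a + b = (x + x') + (y + y')" using a b by (simp add: algebra_simps)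
    then show "a + b \<in> {x + y |x y. x \<in> U \<and> y \<in> V}"
      using a b add_subgroupD(2) U(1) V(1) by blast
  qed
  show "a * x \<in> {x + y |x y. x \<in> U \<and> y \<in> V}" if "a \<in> {x + y |x y. x \<in> U \<and> y \<in> V}" for a x
    using that U(2) V(2) by (auto simp: distrib_right) blast
  show "component x \<gamma> \<in> {x + y |x y. x \<in> U \<and> y \<in> V}"
    if "x \<in> {x + y |x y. x \<in> U \<and> y \<in> V}" "\<gamma> \<in> \<Gamma>" for x \<gamma>
    using that U(3) V(3) unfolding homogeneous_closed_def component_add
    by (auto simp: component_add) blast
qed

lemma graded_right_ideal_mult:
  assumes "graded_right_ideal \<Gamma> R V" "\<gamma> \<in> \<Gamma>" "c \<in> R \<gamma>"
  shows "graded_right_ideal \<Gamma> R ((\<lambda>x. c * x) ` V)"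
proof (rule graded_right_idealI)
  note V = graded_right_idealD[OF assms(1)]
  show sub: "add_subgroup ((\<lambda>x. c * x) ` V)"
    unfolding add_subgroup_def
  proof (intro conjI ballI)
    show "0 \<in> (\<lambda>x. c * x) ` V" using add_subgroupD(1)[OF V(1)] by force
    fix a assume "a \<in> (\<lambda>x. c * x) ` V"
    then obtain x where x: "a = c * x" "x \<in> V" by blast
    then show "- a \<in> (\<lambda>x. c * x) ` V"
      using add_subgroupD(3)[OF V(1)] by (metis image_eqI mult_minus_right)
    fix b assume "b \<in> (\<lambda>x. c * x) ` V"
    then show "a + b \<in> (\<lambda>x. c * x) ` V"
      using x add_subgroupD(2)[OF V(1)] by (auto simp flip: distrib_left)
  qed
  show "a * x \<in> (\<lambda>x. c * x) ` V" if "a \<in> (\<lambda>x. c * x) ` V" for a x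
    using that V(2) by (auto simp: mult.assoc)
  show "component x \<delta> \<in> (\<lambda>x. c * x) ` V" if x: "x \<in> (\<lambda>x. c * x) ` V" and "\<delta> \<in> \<Gamma>" for x \<delta>
  proof -
    obtain v where v: "x = c * v" "v \<in> V" using x by blast
    show ?thesis
      using component_mult_cases[OF assms(2,3), of v \<delta>] v(2) V(3) add_subgroupD(1)[OF sub]
      unfolding v(1) homogeneous_closed_def by auto
  qed
qed

lemma graded_right_ideal_vimage:
  assumes "graded_right_ideal \<Gamma> R M" "\<gamma> \<in> \<Gamma>" "c \<in> R \<gamma>"
  shows "graded_right_ideal \<Gamma> R {x. c * x \<in> M}"
proof (rule graded_right_idealI)
  note M = graded_right_idealD[OF assms(1)]
  show "add_subgroup {x. c * x \<in> M}"
    using M(1) unfolding add_subgroup_def by (auto simp: distrib_left)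
  show "a * x \<in> {x. c * x \<in> M}" if "a \<in> {x. c * x \<in> M}" for a x
    using that M(2)[of "c * a" x] by (simp add: mult.assoc)
  show "component x \<beta> \<in> {x. c * x \<in> M}" if x: "x \<in> {x. c * x \<in> M}" and \<beta>: "\<beta> \<in> \<Gamma>" for x \<beta>
  proof (cases "d \<gamma> = r \<beta>")
    case True
    then have "component (c * x) (\<gamma> \<cdot> \<beta>) = c * component x \<beta>" "\<gamma> \<cdot> \<beta> \<in> \<Gamma>"
      using component_mult_comp comp_closed assms \<beta> by auto
    then show ?thesis using x M(3) unfolding homogeneous_closed_def by force
  next
    case False
    then have "c * component x \<beta> = 0" using mult_zero component_mem assms \<beta> by auto
    then show ?thesis using add_subgroupD(1)[OF M(1)] by simp
  qed
qed

text \<open>It suffices to treat a product \<open>a * b\<close>. Splitting \<open>a\<close> into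
  components makes the left factor homogeneous, and then \<open>component_mult_cases\<close> applies
  to each summand.\<close>

lemma homogeneous_closed_ideal_prod:
  assumes "homogeneous_closed A" "homogeneous_closed B"
  shows "homogeneous_closed (ideal_prod A B)"
proof -
  let ?P = "ideal_prod A B"
  note P = add_subgroup_ideal_prod[of A B]
  have "?P \<subseteq> {x. \<forall>\<gamma>\<in>\<Gamma>. component x \<gamma> \<in> ?P}"
  proof (subst ideal_prod_subset_iff)
    show "add_subgroup {x. \<forall>\<gamma>\<in>\<Gamma>. component x \<gamma> \<in> ?P}"
      using P unfolding add_subgroup_def
      by (auto simp: component_add component_zero component_uminus)
    show "\<forall>a\<in>A. \<forall>b\<in>B. a * b \<in> {x. \<forall>\<gamma>\<in>\<Gamma>. component x \<gamma> \<in> ?P}"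
    proof (intro ballI CollectI)
      fix a b \<gamma> assume a: "a \<in> A" and b: "b \<in> B" and "\<gamma> \<in> \<Gamma>"
      have "component (component a \<alpha> * b) \<gamma> \<in> ?P" if "\<alpha> \<in> \<Gamma>" for \<alpha>
        using component_mult_cases[OF that component_mem[OF that, of a], of b \<gamma>]
          assms a b that add_subgroupD(1)[OF P]
        unfolding homogeneous_closed_def by (auto intro!: ideal_prodI)
      then have "(\<Sum>\<alpha> | component a \<alpha> \<noteq> 0. component (component a \<alpha> * b) \<gamma>) \<in> ?P"
        using component_outside by (intro add_subgroup_sum[OF P]) auto
      then show "component (a * b) \<gamma> \<in> ?P"
        by (simp add: eq_sum_component_mult[of a b] component_sum)
    qed
  qed
  then show ?thesis unfolding homogeneous_closed_def by blast
qed

lemma graded_right_ideal_power: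
  assumes "graded_right_ideal \<Gamma> R U" "n \<ge> 1"
  shows "graded_right_ideal \<Gamma> R (ideal_power U n)"
proof -
  have "homogeneous_closed (ideal_power U n)"
    using assms(2)
  proof (induction n rule: dec_induct)
    case base
    then show ?case using graded_right_idealD(3)[OF assms(1)] by simp
  next
    case (step n)
    then show ?case
      using homogeneous_closed_ideal_prod graded_right_idealD(3)[OF assms(1)]
      by (simp add: ideal_power_Suc)
  qed
  then show ?thesis
    using assms ideal_power_Suc_subset(1) unfolding graded_right_ideal_iff by blast
qed

section \<open>Object units\<close>

lemma identitiesD: "e \<in> identities \<Gamma> d \<Longrightarrow> e \<in> \<Gamma> \<and> d e = e \<and> r e = e"
  unfolding identities_def using d_closed d_d r_d by auto

lemma d_identity: "\<gamma> \<in> \<Gamma> \<Longrightarrow> d \<gamma> \<in> identities \<Gamma> d"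
  and r_identity: "\<gamma> \<in> \<Gamma> \<Longrightarrow> r \<gamma> \<in> identities \<Gamma> d"
  unfolding identities_def by (auto, metis d_r imageI r_closed)

lemma unit_idem: "e \<in> identities \<Gamma> d \<Longrightarrow> u e * u e = u e"
  using unit_left[of e "u e"] identitiesD[of e] unit_mem[of e] by simp

lemma unit_orthogonal:
  "e \<in> identities \<Gamma> d \<Longrightarrow> f \<in> identities \<Gamma> d \<Longrightarrow> e \<noteq> f \<Longrightarrow> u e * u f = 0"
  using mult_zero[of e f "u e" "u f"] identitiesD unit_mem by simp

text \<open>The object units stand in for a global unit: a homogeneous \<open>a\<close> equals
  \<open>u (r \<gamma>) * a\<close>, and homogeneous elements generate the ring.\<close>

lemma eq_UNIV_if_units:
  assumes "right_ideal V" "\<And>e. e \<in> identities \<Gamma> d \<Longrightarrow> u e \<in> V"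
  shows "V = UNIV"
proof -
  have "a \<in> V" if "\<gamma> \<in> \<Gamma>" "a \<in> R \<gamma>" for a \<gamma>
    using assms unit_left[OF that] r_identity[OF that(1)] unfolding right_ideal_def by metis
  moreover have "homogeneous_closed UNIV" by (simp add: homogeneous_closed_def)
  ultimately have "UNIV \<subseteq> V"
    using assms(1) unfolding right_ideal_def by (intro subset_if_homogeneous) auto
  then show ?thesis by blast
qed

text \<open>Multiplication by \<open>u (r \<gamma>)\<close> preserves the component in degree
  \<open>\<gamma>\<close>, so an element killed by all object units has only zero
  components.\<close>

lemma exists_unit_mult_nonzero:
  assumes "x \<noteq> 0"
  shows "\<exists>e\<in>identities \<Gamma> d. u e * x \<noteq> 0"
proof (rule ccontr)
  assume "\<not> ?thesis"
  then have *: "u e * x = 0" if "e \<in> identities \<Gamma> d" for e using that by blast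
  have "component x \<gamma> = 0" if \<gamma>: "\<gamma> \<in> \<Gamma>" for \<gamma>
  proof -
    note e = r_identity[OF \<gamma>]
    have "component (u (r \<gamma>) * x) (r \<gamma> \<cdot> \<gamma>) = u (r \<gamma>) * component x \<gamma>"
      using component_mult_comp[of "r \<gamma>" "u (r \<gamma>)" \<gamma> x] identitiesD[OF e] unit_mem[OF e] \<gamma> by simp
    then show ?thesis
      using *[OF e] component_zero unit_left[OF \<gamma> component_mem[OF \<gamma>]] by simp
  qed
  then have "x = 0"
    using sum_component[of x] component_outside by (metis (mono_tags, lifting) mem_Collect_eq sum.neutral)
  then show False using assms by simp
qed

section \<open>The graded radical\<close>

text \<open>Without a global unit a union of a chain of proper ideals may be the whole ring, so
  Zorn's lemma is applied to the graded right ideals above \<open>K\<close> that avoid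
  \<open>u e\<close>. As \<open>K\<close> contains all other object units, such ideals are exactly
  the proper ones above \<open>K\<close>.\<close>

lemma exists_gr_maximal:
  assumes K: "graded_right_ideal \<Gamma> R K" and e: "e \<in> identities \<Gamma> d" "u e \<notin> K"
    and others: "\<And>f. f \<in> identities \<Gamma> d \<Longrightarrow> f \<noteq> e \<Longrightarrow> u f \<in> K"
  shows "\<exists>M. gr_maximal_right_ideal \<Gamma> R M \<and> K \<subseteq> M \<and> u e \<notin> M"
proof -
  let ?A = "{V. graded_right_ideal \<Gamma> R V \<and> K \<subseteq> V \<and> u e \<notin> V}"
  have "\<exists>M\<in>?A. \<forall>X\<in>?A. M \<subseteq> X \<longrightarrow> X = M"
  proof (rule subset_Zorn_nonempty)
    show "?A \<noteq> {}" using K e(2) by blast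
    fix \<C> assume ne: "\<C> \<noteq> {}" and ch: "subset.chain ?A \<C>"
    then have \<C>: "\<C> \<subseteq> ?A" and lin: "\<And>X Y. X \<in> \<C> \<Longrightarrow> Y \<in> \<C> \<Longrightarrow> X \<subseteq> Y \<or> Y \<subseteq> X"
      unfolding subset_chain_def by auto
    have V: "add_subgroup V" "\<And>a x. a \<in> V \<Longrightarrow> a * x \<in> V" "homogeneous_closed V" if "V \<in> \<C>" for V
      using graded_right_idealD[of V] that \<C> by auto
    have "graded_right_ideal \<Gamma> R (\<Union>\<C>)"
    proof (rule graded_right_idealI)
      show "add_subgroup (\<Union>\<C>)"
        unfolding add_subgroup_def
      proof (intro conjI ballI)
        show "0 \<in> \<Union>\<C>" using ne V(1) add_subgroupD(1) by blast
        fix a assume "a \<in> \<Union>\<C>"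
        then obtain X where X: "X \<in> \<C>" "a \<in> X" by blast
        then show "- a \<in> \<Union>\<C>" using V(1) add_subgroupD(3) by blast
        fix b assume "b \<in> \<Union>\<C>"
        then obtain Y where Y: "Y \<in> \<C>" "b \<in> Y" by blast
        from lin[OF X(1) Y(1)] obtain Z where "Z \<in> \<C>" "a \<in> Z" "b \<in> Z" using X Y by blast
        then show "a + b \<in> \<Union>\<C>" using V(1) add_subgroupD(2) by blast
      qed
      show "a * x \<in> \<Union>\<C>" if "a \<in> \<Union>\<C>" for a x using that V(2) by blast
      show "component x \<gamma> \<in> \<Union>\<C>" if "x \<in> \<Union>\<C>" "\<gamma> \<in> \<Gamma>" for x \<gamma>
        using that V(3) unfolding homogeneous_closed_def by blast
    qed
    then show "\<Union>\<C> \<in> ?A" using ne \<C> by blast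
  qed
  then obtain M where MA: "M \<in> ?A" and "\<forall>X\<in>?A. M \<subseteq> X \<longrightarrow> X = M" by (elim bexE)
  then have M: "graded_right_ideal \<Gamma> R M" "K \<subseteq> M" "u e \<notin> M"
    and max: "\<And>X. X \<in> ?A \<Longrightarrow> M \<subseteq> X \<Longrightarrow> X = M" by simp_all
  have "V = M" if V: "graded_right_ideal \<Gamma> R V" "V \<noteq> UNIV" "M \<subseteq> V" for V
  proof (rule max)
    have "u e \<notin> V"
    proof
      assume "u e \<in> V"
      then have "V = UNIV"
        using V others M(2) by (intro eq_UNIV_if_units) (auto simp: graded_right_ideal_iff)
      then show False using V(2) by simp
    qed
    then show "V \<in> ?A" using V M(2) by blast
  qed (rule V(3))
  then show ?thesis using M unfolding gr_maximal_right_ideal_def by blast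
qed

lemma graded_right_ideal_rad: "graded_right_ideal \<Gamma> R (gr_rad \<Gamma> R)"
  unfolding gr_rad_def
  by (rule graded_right_ideal_Inter) (auto simp: gr_maximal_right_ideal_def)

text \<open>The sum \<open>V + M\<close> is graded and strictly larger than \<open>M\<close>, hence
  the whole ring.\<close>

lemma gr_maximalD:
  assumes M: "gr_maximal_right_ideal \<Gamma> R M" and V: "graded_right_ideal \<Gamma> R V" "v \<in> V" "v \<notin> M"
  shows "\<exists>w\<in>V. \<exists>m\<in>M. y = w + m"
proof -
  let ?S = "{x + y |x y. x \<in> V \<and> y \<in> M}"
  have MM: "graded_right_ideal \<Gamma> R M" using M unfolding gr_maximal_right_ideal_def by blast
  have "0 \<in> M" "0 \<in> V"
    using add_subgroupD(1)[OF graded_right_idealD(1)] MM V(1) by blast+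
  then have "M \<subseteq> ?S" "v \<in> ?S" using V(2) by force+
  then have "?S = UNIV"
    using M graded_right_ideal_plus[OF V(1) MM] V(3) unfolding gr_maximal_right_ideal_def by blast
  then show ?thesis by blast
qed

lemma gr_maximal_vimage:
  assumes M: "gr_maximal_right_ideal \<Gamma> R M" and c: "\<gamma> \<in> \<Gamma>" "c \<in> R \<gamma>"
    and proper: "{x. c * x \<in> M} \<noteq> UNIV"
  shows "gr_maximal_right_ideal \<Gamma> R {x. c * x \<in> M}"
proof -
  have MM: "graded_right_ideal \<Gamma> R M" using M unfolding gr_maximal_right_ideal_def by blast
  have "V \<subseteq> {x. c * x \<in> M}"
    if V: "graded_right_ideal \<Gamma> R V" "V \<noteq> UNIV" "{x. c * x \<in> M} \<subseteq> V" for V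
  proof (rule ccontr)
    assume "\<not> V \<subseteq> {x. c * x \<in> M}"
    then obtain v where v: "v \<in> V" "c * v \<notin> M" by blast
    have "y \<in> V" for y
    proof -
      obtain w m where w: "w \<in> V" "m \<in> M" "c * y = c * w + m"
        \<comment> \<open>The graded right ideal \<open>c V\<close> is not inside \<open>M\<close>,
          so \<open>c V + M\<close> is everything. Decomposing \<open>c * y\<close> puts
          \<open>y - w\<close> into the pullback of \<open>M\<close>, which lies in
          \<open>V\<close>.\<close>
        using gr_maximalD[OF M graded_right_ideal_mult[OF V(1) c] imageI[OF v(1)] v(2), of "c * y"]
        by blast
      then have "c * (y - w) = m" by (simp add: right_diff_distrib)
      then have "y - w \<in> V" using w(2) V(3) by blast
      then have "(y - w) + w \<in> V"
        using w(1) add_subgroupD(2)[OF graded_right_idealD(1)[OF V(1)]] by blast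
      then show ?thesis by simp
    qed
    then show False using V(2) by blast
  qed
  then show ?thesis
    using graded_right_ideal_vimage[OF MM c] proper unfolding gr_maximal_right_ideal_def by blast
qed

lemma graded_left_ideal_rad: "graded_left_ideal \<Gamma> R (gr_rad \<Gamma> R)"
proof -
  note J = graded_right_idealD[OF graded_right_ideal_rad]
  have hom: "c * a \<in> gr_rad \<Gamma> R" if c: "\<gamma> \<in> \<Gamma>" "c \<in> R \<gamma>" and a: "a \<in> gr_rad \<Gamma> R" for c a \<gamma>
    unfolding gr_rad_def
  proof safe
    fix M assume M: "gr_maximal_right_ideal \<Gamma> R M"
    show "c * a \<in> M"
      \<comment> \<open>The pullback of \<open>M\<close> along \<open>c\<close> is the whole ring or
        gr-maximal; either way it contains \<open>a\<close>.\<close>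
      using gr_maximal_vimage[OF M c] a unfolding gr_rad_def by blast
  qed
  have "x * a \<in> gr_rad \<Gamma> R" if "a \<in> gr_rad \<Gamma> R" for x a
    unfolding eq_sum_component_mult[of x a]
    using that hom component_mem component_outside by (intro add_subgroup_sum[OF J(1)]) blast
  then show ?thesis using J unfolding graded_left_ideal_iff left_ideal_def by blast
qed

text \<open>For \<open>a \<noteq> 0\<close> the right annihilator of \<open>a\<close> contains all
  object units except \<open>u (d \<gamma>)\<close>, so some gr-maximal \<open>M\<close> above it
  avoids \<open>u (d \<gamma>)\<close>. But \<open>u (d \<gamma>) - x\<close> annihilates
  \<open>a\<close>, and \<open>x\<close> is in the radical, so both lie in \<open>M\<close>.\<close>

lemma graded_Nakayama:
  assumes a: "\<gamma> \<in> \<Gamma>" "a \<in> R \<gamma>" and x: "x \<in> gr_rad \<Gamma> R" "a = a * x"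
  shows "a = 0"
proof (rule ccontr)
  assume "a \<noteq> 0"
  \<comment> \<open>Written as a pullback of \<open>{0}\<close>, so that
    \<open>graded_right_ideal_vimage\<close> applies.\<close>
  let ?K = "{y. a * y \<in> {0}}" and ?e = "d \<gamma>"
  have e: "?e \<in> identities \<Gamma> d" using d_identity a by blast
  have "u f \<in> ?K" if "f \<in> identities \<Gamma> d" "f \<noteq> ?e" for f
    using mult_zero[OF a(1) _ _ a(2) unit_mem[OF that(1)]] identitiesD[OF that(1)] that(2) by simp
  moreover have "u ?e \<notin> ?K" using unit_right[OF a] \<open>a \<noteq> 0\<close> by simp
  ultimately obtain M where M: "gr_maximal_right_ideal \<Gamma> R M" "?K \<subseteq> M" "u ?e \<notin> M"
    using exists_gr_maximal[OF graded_right_ideal_vimage[OF graded_right_ideal_zero a] e] by blast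
  have "a * (u ?e - x) = 0" using x(2) unit_right[OF a] by (simp add: right_diff_distrib)
  then have "u ?e - x \<in> M" "x \<in> M" using M x(1) unfolding gr_rad_def by auto
  then have "(u ?e - x) + x \<in> M"
    using M(1) graded_right_idealD(1) add_subgroupD(2) unfolding gr_maximal_right_ideal_def by blast
  then show False using M(3) by simp
qed

lemma nilpotent_subset_rad:
  assumes N: "homogeneous_closed N" "nilpotent_ideal N" "right_ideal N \<or> left_ideal N"
  shows "N \<subseteq> gr_rad \<Gamma> R"
proof (rule subset_if_homogeneous[OF N(1)])
  show "add_subgroup (gr_rad \<Gamma> R)" using graded_right_idealD(1)[OF graded_right_ideal_rad] .
  fix a \<gamma> assume a: "\<gamma> \<in> \<Gamma>" "a \<in> R \<gamma>" "a \<in> N"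
  show "a \<in> gr_rad \<Gamma> R"
    unfolding gr_rad_def
  proof safe
    fix M assume M: "gr_maximal_right_ideal \<Gamma> R M"
    then have "graded_right_ideal \<Gamma> R M" unfolding gr_maximal_right_ideal_def by blast
    note MM = graded_right_idealD[OF this]
    show "a \<in> M"
    proof (rule ccontr)
      assume "a \<notin> M"
      let ?f = "r \<gamma>"
      \<comment> \<open>The unit \<open>u (d \<gamma>)\<close> shows that \<open>a\<close> lies in
        \<open>a R\<close>; thus \<open>a R\<close> is not inside \<open>M\<close>.\<close>
      have "a \<in> (\<lambda>x. a * x) ` UNIV" using unit_right[OF a(1,2)] by (metis rangeI)
      from gr_maximalD[OF M graded_right_ideal_mult[OF graded_right_ideal_UNIV a(1,2)] this
          \<open>a \<notin> M\<close>, of "u ?f"]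
      obtain x m where x: "m \<in> M" "u ?f = a * x + m" by blast
      then have base: "u ?f - a * x \<in> M" by simp
      have ua: "u ?f * a = a" using unit_left a by blast
      \<comment> \<open>Since \<open>u ?f * a = a\<close>, multiplying \<open>u ?f - z\<close> by
        \<open>a * x\<close> gives \<open>a * x - z * a * x\<close>; adding
        \<open>u ?f - a * x\<close> cancels \<open>a * x\<close>.\<close>
      have push: "u ?f - z * a * x \<in> M" if "u ?f - z \<in> M" for z
      proof -
        have "u ?f - z * a * x = (u ?f - z) * (a * x) + (u ?f - a * x)"
          by (simp add: left_diff_distrib mult.assoc[symmetric] ua)
        then show ?thesis using MM(2)[OF that] base add_subgroupD(2)[OF MM(1)] by metis
      qed
      obtain n where n: "n \<ge> 1" "ideal_power N n = {0}"
        using N(2) unfolding nilpotent_ideal_def by blast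
      have "u ?f \<in> M"
        using N(3)
      proof
        assume R: "right_ideal N"
        \<comment> \<open>The witness is the \<open>n\<close>-fold product of \<open>a * x\<close>,
          an element of the right ideal \<open>N\<close>.\<close>
        have "\<exists>z\<in>ideal_power N n. u ?f - z \<in> M"
          using n(1)
        proof (induction n rule: dec_induct)
          case base
          have "a * x \<in> N" using R a unfolding right_ideal_def by blast
          then show ?case using \<open>u ?f - a * x \<in> M\<close> by auto
        next
          case (step n)
          then obtain z where z: "z \<in> ideal_power N n" "u ?f - z \<in> M" by blast
          have "z * (a * x) \<in> ideal_power N (Suc n)"
            unfolding ideal_power_Suc[OF step.hyps(1)]
            using z R a unfolding right_ideal_def by (intro ideal_prodI) auto
          then show ?case using push[OF z(2)]
            by (auto simp: mult.assoc)
        qed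
        then show ?thesis using n(2) by auto
      next
        assume L: "left_ideal N"
        \<comment> \<open>Now it is \<open>x * a\<close> that is known to lie in \<open>N\<close>,
          so the last \<open>x\<close> is kept outside: \<open>z\<close> is \<open>a\<close>
          followed by \<open>n - 1\<close> factors \<open>x * a\<close>.\<close>
        have "\<exists>z\<in>ideal_power N n. u ?f - z * x \<in> M"
          using n(1)
        proof (induction n rule: dec_induct)
          case base
          then show ?case using \<open>u ?f - a * x \<in> M\<close> a by auto
        next
          case (step n)
          then obtain z where z: "z \<in> ideal_power N n" "u ?f - z * x \<in> M" by blast
          have "z * (x * a) \<in> ideal_power N (Suc n)"
            unfolding ideal_power_Suc[OF step.hyps(1)]
            using z L a unfolding left_ideal_def by (intro ideal_prodI) auto
          then show ?case using push[OF z(2)]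
            by (intro bexI[of _ "z * (x * a)"]) (simp_all add: mult.assoc)
        qed
        then show ?thesis using n(2) by auto
      qed
      \<comment> \<open>\<open>a = u ?f * a\<close> would lie in the right ideal
        \<open>M\<close>.\<close>
      then show False using MM(2) ua \<open>a \<notin> M\<close> by metis
    qed
  qed
qed

section \<open>Chain conditions\<close>

text \<open>The chain condition makes strict inclusion well-founded below
  \<open>unit_part u e UNIV\<close>. Every graded right ideal inside \<open>U\<close> stays below
  it, so minimality holds against all of them.\<close>

lemma exists_minimal_in_unit_part:
  assumes art: "right_\<Gamma>0_artinian \<Gamma> d R u" and e: "e \<in> identities \<Gamma> d"
    and V: "graded_right_ideal \<Gamma> R V" "V \<subseteq> unit_part u e UNIV" "P V"
  shows "\<exists>U. graded_right_ideal \<Gamma> R U \<and> U \<subseteq> unit_part u e UNIV \<and> P U \<and>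
    (\<forall>W. graded_right_ideal \<Gamma> R W \<and> W \<subset> U \<longrightarrow> \<not> P W)"
proof -
  let ?Q = "\<lambda>U. graded_right_ideal \<Gamma> R U \<and> U \<subseteq> unit_part u e UNIV"
  let ?rel = "{(W, U). ?Q W \<and> ?Q U \<and> W \<subset> U}"
  have "wf ?rel"
    unfolding wf_iff_no_infinite_down_chain
  proof
    assume "\<exists>U. \<forall>i. (U (Suc i), U i) \<in> ?rel"
    then obtain U where "\<forall>i. (U (Suc i), U i) \<in> ?rel" by blast
    then have "\<forall>i. ?Q (U i)" "\<forall>i. U (Suc i) \<subset> U i" by auto
    then show False using art e unfolding right_\<Gamma>0_artinian_def by blast
  qed
  then obtain U where U: "U \<in> {U. ?Q U \<and> P U}"
    and min: "\<And>W. (W, U) \<in> ?rel \<Longrightarrow> W \<notin> {U. ?Q U \<and> P U}"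
    using wfE_min[of ?rel V "{U. ?Q U \<and> P U}"] V by blast
  have "\<not> P W" if "graded_right_ideal \<Gamma> R W" "W \<subset> U" for W
    using min[of W] U that by blast
  then show ?thesis using U by blast
qed

lemma nilpotent_rad:
  assumes art: "right_\<Gamma>0_artinian \<Gamma> d R u"
    and k: "k \<ge> 1" "ideal_power (gr_rad \<Gamma> R) k = ideal_power (gr_rad \<Gamma> R) (k + 1)"
  shows "nilpotent_ideal (gr_rad \<Gamma> R)"
proof (rule ccontr)
  assume non: "\<not> nilpotent_ideal (gr_rad \<Gamma> R)"
  define I where "I = ideal_power (gr_rad \<Gamma> R) k"
  have I: "graded_right_ideal \<Gamma> R I"
    unfolding I_def using graded_right_ideal_power[OF graded_right_ideal_rad k(1)] .
  have IJ: "I \<subseteq> gr_rad \<Gamma> R"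
    unfolding I_def using ideal_power_subset graded_right_ideal_rad k(1)
    unfolding graded_right_ideal_iff by blast
  have idem: "I \<subseteq> ideal_prod I I"
    using ideal_power_add_subset[OF k(1) k(1), of "gr_rad \<Gamma> R"] ideal_power_stable[OF k, of k]
    unfolding I_def by simp
  have "I \<noteq> {0}" using non k(1) unfolding nilpotent_ideal_def I_def by blast
  then obtain y where y: "y \<in> I" "y \<noteq> 0"
    using add_subgroupD(1)[OF graded_right_idealD(1)[OF I]] by blast
  then obtain e where e: "e \<in> identities \<Gamma> d" "u e * y \<noteq> 0"
    using exists_unit_mult_nonzero by blast
  \<comment> \<open>\<open>?P U\<close> says \<open>U I \<noteq> 0\<close>. The choice of
    \<open>e\<close> and \<open>y\<close> makes it true for \<open>unit_part u e UNIV\<close>, from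
    which a minimal \<open>U\<close> is obtained.\<close>
  let ?P = "\<lambda>U. \<exists>x\<in>U. \<exists>y\<in>I. x * y \<noteq> 0"
  have "graded_right_ideal \<Gamma> R (unit_part u e UNIV)"
    unfolding unit_part_def
    using graded_right_ideal_mult[OF graded_right_ideal_UNIV] e(1) identitiesD unit_mem by blast
  moreover have "u e \<in> unit_part u e UNIV"
    unfolding unit_part_def using unit_idem[OF e(1)] by (intro image_eqI[of _ _ "u e"]) simp_all
  then have "?P (unit_part u e UNIV)" using e(2) y(1) by blast
  ultimately have "\<exists>U. graded_right_ideal \<Gamma> R U \<and> U \<subseteq> unit_part u e UNIV \<and> ?P U \<and>
      (\<forall>W. graded_right_ideal \<Gamma> R W \<and> W \<subset> U \<longrightarrow> \<not> ?P W)"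
    by (intro exists_minimal_in_unit_part[OF art e(1) _ subset_refl])
  then obtain U where U: "graded_right_ideal \<Gamma> R U" "U \<subseteq> unit_part u e UNIV" "?P U"
    and min: "\<forall>W. graded_right_ideal \<Gamma> R W \<and> W \<subset> U \<longrightarrow> \<not> ?P W"
    by (elim exE conjE)
  obtain x z where xz: "x \<in> U" "z \<in> I" "x * z \<noteq> 0" using U(3) by blast
  \<comment> \<open>A homogeneous factor is wanted because \<open>a I\<close> is then graded and can
    be compared with the minimal \<open>U\<close>.\<close>
  have "\<exists>\<gamma>. component x \<gamma> * z \<noteq> 0"
  proof (rule ccontr)
    assume "\<not> ?thesis"
    then show False using xz(3) eq_sum_component_mult[of x z] by simp
  qed
  then obtain \<gamma> where \<gamma>: "component x \<gamma> * z \<noteq> 0" "component x \<gamma> \<noteq> 0"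
    by fastforce
  define a where "a = component x \<gamma>"
  note UU = graded_right_idealD[OF U(1)]
  have a: "\<gamma> \<in> \<Gamma>" "a \<in> R \<gamma>" "a \<in> U" "a * z \<noteq> 0" "a \<noteq> 0"
    using \<gamma> component_outside component_mem component_in[OF UU(3,1) xz(1)]
    unfolding a_def by blast+
  have aI: "(\<lambda>x. a * x) ` I \<subseteq> U" using a(3) UU(2) by blast
  \<comment> \<open>If \<open>(a I) I = 0\<close>, then \<open>a\<close> annihilates
    \<open>ideal_prod I I\<close>, hence \<open>I\<close>, against \<open>a * z \<noteq> 0\<close>.
    Minimality then gives \<open>a I = U\<close>, which contains \<open>a\<close>.\<close>
  have "?P ((\<lambda>x. a * x) ` I)"
  proof (rule ccontr)
    assume "\<not> ?thesis"
    then have "\<forall>s\<in>I. \<forall>t\<in>I. s * t \<in> {w. a * w = 0}" by (simp add: mult.assoc)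
    moreover have "add_subgroup {w. a * w = 0}" by (auto simp: add_subgroup_def distrib_left)
    ultimately have "I \<subseteq> {w. a * w = 0}" using ideal_prod_subset_iff idem by blast
    then show False using xz(2) a(4) by blast
  qed
  then have "(\<lambda>x. a * x) ` I = U"
    using min[rule_format, of "(\<lambda>x. a * x) ` I"] graded_right_ideal_mult[OF I a(1,2)] aI
    by (auto simp: psubset_eq)
  then obtain w where "w \<in> I" "a = a * w" using a(3) by blast
  then show False using graded_Nakayama[OF a(1,2)] IJ a(5) by blast
qed

lemma is_largest_rad:
  assumes "nilpotent_ideal (gr_rad \<Gamma> R)"
  shows "is_largest (\<lambda>U. graded_left_ideal \<Gamma> R U \<and> nilpotent_ideal U) (gr_rad \<Gamma> R)"
    and "is_largest (\<lambda>U. graded_right_ideal \<Gamma> R U \<and> nilpotent_ideal U) (gr_rad \<Gamma> R)"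
  using assms graded_left_ideal_rad graded_right_ideal_rad nilpotent_subset_rad
  unfolding is_largest_def graded_left_ideal_iff graded_right_ideal_iff by blast+

section \<open>Comparison of the chain conditions and stabilization of powers\<close>

lemma gr_artinian_imp_\<Gamma>0_artinian:
  "right_gr_artinian \<Gamma> R \<Longrightarrow> right_\<Gamma>0_artinian \<Gamma> d R u"
  unfolding right_gr_artinian_def right_\<Gamma>0_artinian_def by blast

text \<open>For a chain inside \<open>unit_part u e UNIV\<close> the part at \<open>e\<close> is the
  chain itself, so consecutive parts never agree there, and the parts at other identities are all
  \<open>{0}\<close>. The extra requirement on the chain thus holds automatically.\<close>

lemma strongly_\<Gamma>0_artinian_imp_\<Gamma>0_artinian:
  assumes "right_strongly_\<Gamma>0_artinian \<Gamma> d R u"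
  shows "right_\<Gamma>0_artinian \<Gamma> d R u"
  unfolding right_\<Gamma>0_artinian_def
proof (intro ballI notI, elim exE conjE)
  fix e and U :: "nat \<Rightarrow> 'r set"
  assume e: "e \<in> identities \<Gamma> d"
    and U: "\<forall>i. graded_right_ideal \<Gamma> R (U i) \<and> U i \<subseteq> unit_part u e UNIV"
    and dec: "\<forall>i. U (Suc i) \<subset> U i"
  have same: "unit_part u e (U i) = U i" for i
  proof -
    have "u e * x = x" if "x \<in> U i" for x
      using U that unit_idem[OF e] unfolding unit_part_def by (auto simp: mult.assoc[symmetric] dest!: spec[of _ i])
    then show ?thesis unfolding unit_part_def by simp
  qed
  have other: "unit_part u f (U i) = {0}" if f: "f \<in> identities \<Gamma> d" "f \<noteq> e" for f i
  proof -
    have "u f * x = 0" if "x \<in> U i" for x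
      using U that unit_orthogonal[OF f(1) e f(2)] unfolding unit_part_def
      by (auto simp: mult.assoc[symmetric] dest!: spec[of _ i])
    moreover have "0 \<in> U i"
      using U add_subgroupD(1)[OF graded_right_idealD(1)] by blast
    ultimately show ?thesis unfolding unit_part_def by force
  qed
  have "\<forall>f\<in>identities \<Gamma> d. \<forall>i. unit_part u f (U i) = unit_part u f (U (Suc i)) \<longrightarrow>
      (\<forall>l\<ge>1. unit_part u f (U i) = unit_part u f (U (i + l)))"
    using same other dec by (metis psubset_eq)
  then show False using assms U dec unfolding right_strongly_\<Gamma>0_artinian_def by blast
qed

lemma gr_artinian_power_stable:
  assumes art: "right_gr_artinian \<Gamma> R" and U: "graded_right_ideal \<Gamma> R U"
  shows "\<exists>k\<ge>1. ideal_power U k = ideal_power U (k + 1)"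
proof (rule ccontr)
  assume "\<not> ?thesis"
  \<comment> \<open>The chain starts at exponent 1, since exponent 0 is \<open>UNIV\<close> by
    convention.\<close>
  then have "\<forall>i. ideal_power U (Suc (Suc i)) \<subset> ideal_power U (Suc i)"
    using ideal_power_Suc_subset(2)[of U] U unfolding graded_right_ideal_iff by force
  moreover have "\<forall>i. graded_right_ideal \<Gamma> R (ideal_power U (Suc i))"
    using graded_right_ideal_power[OF U] by simp
  ultimately show False
    using art unfolding right_gr_artinian_def
    by - (erule notE, rule exI[where x = "\<lambda>i. ideal_power U (Suc i)"], intro conjI, assumption+)
qed

text \<open>The part of a product \<open>A U\<close> at \<open>e\<close> is determined by the part
  of \<open>A\<close> at \<open>e\<close>, so one equality between consecutive powers propagates to
  all later ones.\<close>

lemma unit_part_power_stable: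
  assumes U: "graded_right_ideal \<Gamma> R U" and e: "e \<in> identities \<Gamma> d" and i: "i \<ge> 1"
    and eq: "unit_part u e (ideal_power U i) = unit_part u e (ideal_power U (Suc i))"
  shows "unit_part u e (ideal_power U (i + l)) = unit_part u e (ideal_power U i)"
proof -
  have step: "unit_part u e (ideal_power U (Suc n)) = unit_part u e (ideal_power U (Suc (Suc n)))"
    if n: "n \<ge> 1" and eq: "unit_part u e (ideal_power U n) = unit_part u e (ideal_power U (Suc n))" for n
  proof
    let ?T = "unit_part u e (ideal_power U (Suc (Suc n)))"
    have "right_ideal U" using U unfolding graded_right_ideal_iff by blast
    then show "?T \<subseteq> unit_part u e (ideal_power U (Suc n))"
      unfolding unit_part_def using ideal_power_Suc_subset(2)[of U "Suc n"] by (intro image_mono) simp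
    \<comment> \<open>Then the pullback of \<open>?T\<close> along \<open>u e\<close> is an additive
      subgroup, and the inclusion can be tested on products.\<close>
    have "graded_right_ideal \<Gamma> R ?T"
      unfolding unit_part_def
      using graded_right_ideal_mult[OF graded_right_ideal_power[OF U]] e identitiesD unit_mem
      by (metis le_add1 plus_1_eq_Suc)
    then have T: "add_subgroup {x. u e * x \<in> ?T}"
      using graded_right_ideal_vimage graded_right_idealD(1) e identitiesD unit_mem by blast
    have "a * b \<in> {x. u e * x \<in> ?T}" if a: "a \<in> ideal_power U n" and b: "b \<in> U" for a b
    proof -
      obtain a' where a': "a' \<in> ideal_power U (Suc n)" "u e * a = u e * a'"
        using eq a unfolding unit_part_def by blast
      then have "a' * b \<in> ideal_power U (Suc (Suc n))" using b by (simp add: ideal_prodI)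
      moreover have "u e * (a * b) = u e * (a' * b)" using a'(2) by (metis mult.assoc)
      ultimately show ?thesis unfolding unit_part_def by blast
    qed
    then have "ideal_power U (Suc n) \<subseteq> {x. u e * x \<in> ?T}"
      unfolding ideal_power_Suc[OF n] ideal_prod_subset_iff[OF T] by blast
    then show "unit_part u e (ideal_power U (Suc n)) \<subseteq> ?T" unfolding unit_part_def by blast
  qed
  \<comment> \<open>The second conjunct is carried along because \<open>step\<close> needs the
    equality with the next power.\<close>
  have "unit_part u e (ideal_power U (i + l)) = unit_part u e (ideal_power U i) \<and>
    unit_part u e (ideal_power U (i + l)) = unit_part u e (ideal_power U (Suc (i + l)))"
  proof (induction l)
    case (Suc l)
    then show ?case using step[of "i + l"] i unfolding add_Suc_right by (metis trans_le_add1)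
  qed (use eq in simp)
  then show ?thesis by blast
qed

text \<open>If the powers never stabilized, they would decrease strictly, and
  \<open>unit_part_power_stable\<close> would make them a chain of the forbidden kind.\<close>

lemma strongly_\<Gamma>0_artinian_power_stable:
  assumes art: "right_strongly_\<Gamma>0_artinian \<Gamma> d R u" and U: "graded_right_ideal \<Gamma> R U"
  shows "\<exists>k\<ge>1. ideal_power U k = ideal_power U (k + 1)"
proof (rule ccontr)
  assume "\<not> ?thesis"
  then have "\<forall>i. ideal_power U (Suc (Suc i)) \<subset> ideal_power U (Suc i)"
    using ideal_power_Suc_subset(2)[of U] U unfolding graded_right_ideal_iff by force
  moreover have "\<forall>i. graded_right_ideal \<Gamma> R (ideal_power U (Suc i))"
    using graded_right_ideal_power[OF U] by simp
  moreover have "\<forall>e\<in>identities \<Gamma> d. \<forall>i.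
      unit_part u e (ideal_power U (Suc i)) = unit_part u e (ideal_power U (Suc (Suc i))) \<longrightarrow>
      (\<forall>l\<ge>1. unit_part u e (ideal_power U (Suc i)) = unit_part u e (ideal_power U (Suc (i + l))))"
    using unit_part_power_stable[OF U, of _ "Suc _"] by (metis add_Suc le_add1 plus_1_eq_Suc)
  ultimately show False
    using art unfolding right_strongly_\<Gamma>0_artinian_def
    by - (erule notE, rule exI[where x = "\<lambda>i. ideal_power U (Suc i)"], intro conjI, assumption+)
qed

end

theorem proposition4p4:
  fixes \<Gamma> :: "'g set"
    and comp :: "'g \<Rightarrow> 'g \<Rightarrow> 'g"
    and d r :: "'g \<Rightarrow> 'g"
    and R :: "'g \<Rightarrow> 'r::ring set"
    and u :: "'g \<Rightarrow> 'r"
  assumes "graded_ring \<Gamma> comp d r R u"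
  shows "(right_\<Gamma>0_artinian \<Gamma> d R u \<and>
           (\<exists>k\<ge>1. ideal_power (gr_rad \<Gamma> R) k = ideal_power (gr_rad \<Gamma> R) (k + 1)) \<longrightarrow>
           is_largest (\<lambda>U. graded_left_ideal \<Gamma> R U \<and> nilpotent_ideal U) (gr_rad \<Gamma> R) \<and>
           is_largest (\<lambda>U. graded_right_ideal \<Gamma> R U \<and> nilpotent_ideal U) (gr_rad \<Gamma> R)) \<and>
         (right_strongly_\<Gamma>0_artinian \<Gamma> d R u \<longrightarrow>
           is_largest (\<lambda>U. graded_left_ideal \<Gamma> R U \<and> nilpotent_ideal U) (gr_rad \<Gamma> R) \<and>
           is_largest (\<lambda>U. graded_right_ideal \<Gamma> R U \<and> nilpotent_ideal U) (gr_rad \<Gamma> R)) \<and>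
         (right_gr_artinian \<Gamma> R \<longrightarrow>
           is_largest (\<lambda>U. graded_left_ideal \<Gamma> R U \<and> nilpotent_ideal U) (gr_rad \<Gamma> R) \<and>
           is_largest (\<lambda>U. graded_right_ideal \<Gamma> R U \<and> nilpotent_ideal U) (gr_rad \<Gamma> R))"
proof -
  interpret graded_ring \<Gamma> comp d r R u by (rule assms)
  have "nilpotent_ideal (gr_rad \<Gamma> R)"
    if "right_\<Gamma>0_artinian \<Gamma> d R u"
      "\<exists>k\<ge>1. ideal_power (gr_rad \<Gamma> R) k = ideal_power (gr_rad \<Gamma> R) (k + 1)"
    using nilpotent_rad[OF that(1)] that(2) by (elim exE conjE)
  \<comment> \<open>The other two cases reduce to the implication just shown, available as the first
    fact of \<open>calculation\<close>.\<close>
  moreover have "nilpotent_ideal (gr_rad \<Gamma> R)" if "right_strongly_\<Gamma>0_artinian \<Gamma> d R u"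
    using that by (intro calculation strongly_\<Gamma>0_artinian_imp_\<Gamma>0_artinian
        strongly_\<Gamma>0_artinian_power_stable graded_right_ideal_rad)
  moreover have "nilpotent_ideal (gr_rad \<Gamma> R)" if "right_gr_artinian \<Gamma> R"
    using that by (intro calculation(1) gr_artinian_imp_\<Gamma>0_artinian
        gr_artinian_power_stable graded_right_ideal_rad)
  ultimately show ?thesis
    by (intro conjI impI is_largest_rad) (elim conjE, assumption | blast)+
qed

end
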